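(* There exist a Hilbert $C^*$-module $H$ (that is, a $C^*$-algebra $\mathfrak{A}$ and a Hilbert $\mathfrak{A}$-module $H$) and $A,B\in\mathcal{L}(H)_+$ such that the operator equation $$A^{1/2}=(A+B)^{1/2}X,\qquad X\in\mathcal{L}(H),$$ has no solution.
   Context: For a (right) Hilbert $\mathfrak{A}$-module $H$ over a $C^*$-algebra $\mathfrak{A}$, $\mathcal{L}(H)$ denotes the $C^*$-algebra of adjointable operators $H\to H$ and $\mathcal{L}(H)_+$ its set of positive elements. For $T\in\mathcal{L}(H)_+$, $T^{1/2}$ denotes its positive square root in $\mathcal{L}(H)$. *)

theory Defs
  imports "HOL-Analysis.Abstract_Metric_Spaces" "HOL-Algebra.Module" "HOL-Library.Nonpos_Ints"
begin

section \<open>C*-algebras\<close>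

definition complex_ring :: "complex ring" where
  "complex_ring =
     \<lparr>carrier = UNIV, mult = (*), one = 1, zero = 0, add = (+)\<rparr>"

text \<open>Algebras need not be unital: the field \<^const>\<open>one\<close>, inherited from the record
  \<open>module\<close>, is unconstrained in the locale \<open>cstar_algebra\<close> below.\<close>

record 'a cstar = "(complex, 'a) module" +
  star :: "'a \<Rightarrow> 'a"
  nrm :: "'a \<Rightarrow> real"

text \<open>The distance is set to 0 off the carrier because \<^locale>\<open>Metric_space\<close> requires
  nonnegativity and symmetry on the whole type.\<close>

definition norm_dist :: "('a, 'm) ring_scheme \<Rightarrow> ('a \<Rightarrow> real) \<Rightarrow> 'a \<Rightarrow> 'a \<Rightarrow> real" where
  "norm_dist V \<nu> x y =
     (if x \<in> carrier V \<and> y \<in> carrier V then \<nu> (x \<ominus>\<^bsub>V\<^esub> y) else 0)"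

definition norm_complete :: "('a, 'm) ring_scheme \<Rightarrow> ('a \<Rightarrow> real) \<Rightarrow> bool" where
  "norm_complete V \<nu> \<longleftrightarrow> Metric_space.mcomplete (carrier V) (norm_dist V \<nu>)"

locale cstar_algebra = Module.module complex_ring \<AA>
  for \<AA> :: "('a, 'm) cstar_scheme" (structure) +
  assumes mult_closed: "\<lbrakk>x \<in> carrier \<AA>; y \<in> carrier \<AA>\<rbrakk> \<Longrightarrow> x \<otimes> y \<in> carrier \<AA>"
    and mult_assoc: "\<lbrakk>x \<in> carrier \<AA>; y \<in> carrier \<AA>; z \<in> carrier \<AA>\<rbrakk>
      \<Longrightarrow> (x \<otimes> y) \<otimes> z = x \<otimes> (y \<otimes> z)"
    and mult_l_distr: "\<lbrakk>x \<in> carrier \<AA>; y \<in> carrier \<AA>; z \<in> carrier \<AA>\<rbrakk>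
      \<Longrightarrow> (x \<oplus> y) \<otimes> z = x \<otimes> z \<oplus> y \<otimes> z"
    and mult_r_distr: "\<lbrakk>x \<in> carrier \<AA>; y \<in> carrier \<AA>; z \<in> carrier \<AA>\<rbrakk>
      \<Longrightarrow> z \<otimes> (x \<oplus> y) = z \<otimes> x \<oplus> z \<otimes> y"
    and smult_mult_l: "\<lbrakk>x \<in> carrier \<AA>; y \<in> carrier \<AA>\<rbrakk> \<Longrightarrow> (c \<odot> x) \<otimes> y = c \<odot> (x \<otimes> y)"
    and smult_mult_r: "\<lbrakk>x \<in> carrier \<AA>; y \<in> carrier \<AA>\<rbrakk> \<Longrightarrow> x \<otimes> (c \<odot> y) = c \<odot> (x \<otimes> y)"
    and star_closed: "x \<in> carrier \<AA> \<Longrightarrow> star \<AA> x \<in> carrier \<AA>"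
    and star_star: "x \<in> carrier \<AA> \<Longrightarrow> star \<AA> (star \<AA> x) = x"
    and star_add: "\<lbrakk>x \<in> carrier \<AA>; y \<in> carrier \<AA>\<rbrakk>
      \<Longrightarrow> star \<AA> (x \<oplus> y) = star \<AA> x \<oplus> star \<AA> y"
    and star_smult: "x \<in> carrier \<AA> \<Longrightarrow> star \<AA> (c \<odot> x) = cnj c \<odot> star \<AA> x"
    and star_mult: "\<lbrakk>x \<in> carrier \<AA>; y \<in> carrier \<AA>\<rbrakk>
      \<Longrightarrow> star \<AA> (x \<otimes> y) = star \<AA> y \<otimes> star \<AA> x"
    and nrm_nonneg: "x \<in> carrier \<AA> \<Longrightarrow> 0 \<le> nrm \<AA> x"
    and nrm_eq_0_iff: "x \<in> carrier \<AA> \<Longrightarrow> nrm \<AA> x = 0 \<longleftrightarrow> x = \<zero>"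
    and nrm_triangle: "\<lbrakk>x \<in> carrier \<AA>; y \<in> carrier \<AA>\<rbrakk>
      \<Longrightarrow> nrm \<AA> (x \<oplus> y) \<le> nrm \<AA> x + nrm \<AA> y"
    and nrm_smult: "x \<in> carrier \<AA> \<Longrightarrow> nrm \<AA> (c \<odot> x) = cmod c * nrm \<AA> x"
    and nrm_mult: "\<lbrakk>x \<in> carrier \<AA>; y \<in> carrier \<AA>\<rbrakk>
      \<Longrightarrow> nrm \<AA> (x \<otimes> y) \<le> nrm \<AA> x * nrm \<AA> y"
    and cstar_identity: "x \<in> carrier \<AA> \<Longrightarrow> nrm \<AA> (star \<AA> x \<otimes> x) = (nrm \<AA> x)\<^sup>2"
    and complete: "norm_complete \<AA> (nrm \<AA>)"

section \<open>Positive elements and square roots\<close>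

text \<open>The pair \<open>(a, \<alpha>)\<close> stands for \<open>a + \<alpha> 1\<close>, where \<open>1 = (0, 1)\<close> is the adjoined unit.\<close>

definition unitization :: "('a, 'm) cstar_scheme \<Rightarrow> ('a \<times> complex) monoid" where
  "unitization \<AA> =
     \<lparr>carrier = carrier \<AA> \<times> UNIV,
      mult = (\<lambda>(a, \<alpha>) (b, \<beta>).
        ((a \<otimes>\<^bsub>\<AA>\<^esub> b) \<oplus>\<^bsub>\<AA>\<^esub> (\<alpha> \<odot>\<^bsub>\<AA>\<^esub> b) \<oplus>\<^bsub>\<AA>\<^esub> (\<beta> \<odot>\<^bsub>\<AA>\<^esub> a), \<alpha> * \<beta>)),
      one = (\<zero>\<^bsub>\<AA>\<^esub>, 1)\<rparr>"

text \<open>A unit is adjoined even if the algebra is already unital. In that case the set below is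
  the usual spectrum together with 0, so the condition that the spectrum consists of
  nonnegative real numbers has its usual meaning.\<close>

definition spectrum :: "('a, 'm) cstar_scheme \<Rightarrow> 'a \<Rightarrow> complex set" where
  "spectrum \<AA> a = {z. (a, - z) \<notin> Units (unitization \<AA>)}"

definition positive :: "('a, 'm) cstar_scheme \<Rightarrow> 'a set" where
  "positive \<AA> =
     {a \<in> carrier \<AA>. star \<AA> a = a \<and> spectrum \<AA> a \<subseteq> \<real>\<^sub>\<ge>\<^sub>0}"

definition positive_sqrt :: "('a, 'm) cstar_scheme \<Rightarrow> 'a \<Rightarrow> 'a" where
  "positive_sqrt \<AA> a = (THE s. s \<in> positive \<AA> \<and> s \<otimes>\<^bsub>\<AA>\<^esub> s = a)"

section \<open>Hilbert C*-modules and adjointable operators\<close>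

text \<open>The fields \<^const>\<open>mult\<close> and \<^const>\<open>one\<close> of a module are not used. Inner products are
  linear in the second variable.\<close>

record ('a, 'h) hilbert_module = "(complex, 'h) module" +
  ract :: "'h \<Rightarrow> 'a \<Rightarrow> 'h"
  ip :: "'h \<Rightarrow> 'h \<Rightarrow> 'a"

definition hnorm :: "('a, 'm) cstar_scheme \<Rightarrow> ('a, 'h, 'n) hilbert_module_scheme \<Rightarrow> 'h \<Rightarrow> real"
  where "hnorm \<AA> H x = sqrt (nrm \<AA> (ip H x x))"

locale hilbert_cstar_module =
  cstar_algebra \<AA> + H: Module.module complex_ring H
  for \<AA> :: "('a, 'm) cstar_scheme" and H :: "('a, 'h, 'n) hilbert_module_scheme" +
  assumes ract_closed: "\<lbrakk>x \<in> carrier H; a \<in> carrier \<AA>\<rbrakk> \<Longrightarrow> ract H x a \<in> carrier H"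
    and ract_add_l: "\<lbrakk>x \<in> carrier H; y \<in> carrier H; a \<in> carrier \<AA>\<rbrakk>
      \<Longrightarrow> ract H (x \<oplus>\<^bsub>H\<^esub> y) a = ract H x a \<oplus>\<^bsub>H\<^esub> ract H y a"
    and ract_add_r: "\<lbrakk>x \<in> carrier H; a \<in> carrier \<AA>; b \<in> carrier \<AA>\<rbrakk>
      \<Longrightarrow> ract H x (a \<oplus>\<^bsub>\<AA>\<^esub> b) = ract H x a \<oplus>\<^bsub>H\<^esub> ract H x b"
    and ract_mult: "\<lbrakk>x \<in> carrier H; a \<in> carrier \<AA>; b \<in> carrier \<AA>\<rbrakk>
      \<Longrightarrow> ract H x (a \<otimes>\<^bsub>\<AA>\<^esub> b) = ract H (ract H x a) b"
    and ract_smult_l: "\<lbrakk>x \<in> carrier H; a \<in> carrier \<AA>\<rbrakk>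
      \<Longrightarrow> ract H (c \<odot>\<^bsub>H\<^esub> x) a = c \<odot>\<^bsub>H\<^esub> ract H x a"
    and ract_smult_r: "\<lbrakk>x \<in> carrier H; a \<in> carrier \<AA>\<rbrakk>
      \<Longrightarrow> ract H x (c \<odot>\<^bsub>\<AA>\<^esub> a) = c \<odot>\<^bsub>H\<^esub> ract H x a"
    and ip_closed: "\<lbrakk>x \<in> carrier H; y \<in> carrier H\<rbrakk> \<Longrightarrow> ip H x y \<in> carrier \<AA>"
    and ip_add: "\<lbrakk>x \<in> carrier H; y \<in> carrier H; z \<in> carrier H\<rbrakk>
      \<Longrightarrow> ip H x (y \<oplus>\<^bsub>H\<^esub> z) = ip H x y \<oplus>\<^bsub>\<AA>\<^esub> ip H x z"
    and ip_smult: "\<lbrakk>x \<in> carrier H; y \<in> carrier H\<rbrakk>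
      \<Longrightarrow> ip H x (c \<odot>\<^bsub>H\<^esub> y) = c \<odot>\<^bsub>\<AA>\<^esub> ip H x y"
    and ip_ract: "\<lbrakk>x \<in> carrier H; y \<in> carrier H; a \<in> carrier \<AA>\<rbrakk>
      \<Longrightarrow> ip H x (ract H y a) = ip H x y \<otimes>\<^bsub>\<AA>\<^esub> a"
    and ip_star: "\<lbrakk>x \<in> carrier H; y \<in> carrier H\<rbrakk> \<Longrightarrow> star \<AA> (ip H x y) = ip H y x"
    and ip_positive: "x \<in> carrier H \<Longrightarrow> ip H x x \<in> positive \<AA>"
    and ip_eq_0: "\<lbrakk>x \<in> carrier H; ip H x x = \<zero>\<^bsub>\<AA>\<^esub>\<rbrakk> \<Longrightarrow> x = \<zero>\<^bsub>H\<^esub>"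
    and complete_H: "norm_complete H (hnorm \<AA> H)"

text \<open>Operators are functions that are \<^const>\<open>undefined\<close> off the carrier, so that equality of
  operators is equality of functions. Linearity and boundedness are consequences of having an
  adjoint.\<close>

definition is_adjoint :: "('a, 'h, 'n) hilbert_module_scheme \<Rightarrow> ('h \<Rightarrow> 'h) \<Rightarrow> ('h \<Rightarrow> 'h) \<Rightarrow> bool"
  where "is_adjoint H T S \<longleftrightarrow>
    T \<in> carrier H \<rightarrow>\<^sub>E carrier H \<and> S \<in> carrier H \<rightarrow>\<^sub>E carrier H \<and>
    (\<forall>x \<in> carrier H. \<forall>y \<in> carrier H. ip H (T x) y = ip H x (S y))"

definition adjointable ::
  "('a, 'm) cstar_scheme \<Rightarrow> ('a, 'h, 'n) hilbert_module_scheme \<Rightarrow> ('h \<Rightarrow> 'h) cstar"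
  where "adjointable \<AA> H =
     \<lparr>carrier = {T. \<exists>S. is_adjoint H T S},
      mult = compose (carrier H),
      one = (\<lambda>x \<in> carrier H. x),
      zero = (\<lambda>x \<in> carrier H. \<zero>\<^bsub>H\<^esub>),
      add = (\<lambda>T S. \<lambda>x \<in> carrier H. T x \<oplus>\<^bsub>H\<^esub> S x),
      smult = (\<lambda>c T. \<lambda>x \<in> carrier H. c \<odot>\<^bsub>H\<^esub> T x),
      star = (\<lambda>T. THE S. is_adjoint H T S),
      nrm = (\<lambda>T. SUP x \<in> {x \<in> carrier H. hnorm \<AA> H x \<le> 1}. hnorm \<AA> H (T x))\<rparr>"

end

theory Submission
  imports Defs "HOL-Analysis.Bounded_Continuous_Function" "HOL-Analysis.Complex_Analysis_Basics"
begin

text \<open>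
  Bounded continuous functions on \<open>\<real>\<close> form a unital commutative C*-algebra; regarded as a
  Hilbert module over itself, its adjointable operators are exactly the multiplication operators
  \<open>M\<^sub>h\<close>, and \<open>M\<^sub>h\<close> is positive iff \<open>h \<ge> 0\<close>. Let \<open>u\<close> and \<open>v\<close> be the positive and the negative part
  of \<open>t\<close>, both truncated at 1, and put \<open>A = M\<^bsub>u\<^sup>2\<^esub>\<close>, \<open>B = M\<^bsub>v\<^sup>2\<^esub>\<close>. As \<open>u v = 0\<close>, the square roots of \<open>A\<close>
  and \<open>A + B\<close> are \<open>M\<^sub>u\<close> and \<open>M\<^bsub>u+v\<^esub>\<close>. A solution \<open>X = M\<^sub>h\<close> would satisfy \<open>u = (u + v) h\<close>, hence
  \<open>h = 1\<close> on the positive and \<open>h = 0\<close> on the negative half-line, contradicting continuity at 0.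
\<close>

section \<open>The C*-algebra of bounded continuous functions\<close>

text \<open>The detour through the type of bounded continuous functions gives access to its norm and
  its completeness, while the elements of the algebra stay plain functions.\<close>

definition sup_norm :: "('a::topological_space \<Rightarrow> complex) \<Rightarrow> real" where
  "sup_norm f = norm (Bcontfun f)"

lemma cmod_le_sup_norm: "f \<in> bcontfun \<Longrightarrow> cmod (f t) \<le> sup_norm f"
  using norm_bounded[of "Bcontfun f" t] by (simp add: sup_norm_def Bcontfun_inverse)

lemma sup_norm_le: "f \<in> bcontfun \<Longrightarrow> (\<And>t. cmod (f t) \<le> b) \<Longrightarrow> sup_norm f \<le> b"
  using norm_bound[of "Bcontfun f" b] by (simp add: sup_norm_def Bcontfun_inverse)

lemma sup_norm_nonneg: "0 \<le> sup_norm f"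
  by (simp add: sup_norm_def)

lemma sup_norm_eq_0_iff:
  assumes "f \<in> bcontfun"
  shows "sup_norm f = 0 \<longleftrightarrow> f = (\<lambda>_. 0)"
proof
  assume "sup_norm f = 0"
  then have "cmod (f t) \<le> 0" for t
    using cmod_le_sup_norm[OF assms, of t] by simp
  then show "f = (\<lambda>_. 0)" by auto
next
  assume "f = (\<lambda>_. 0)"
  then have "sup_norm f \<le> 0"
    using assms by (intro sup_norm_le) auto
  then show "sup_norm f = 0"
    using sup_norm_nonneg[of f] by simp
qed

lemma mult_cont:
  fixes f g :: "'a::topological_space \<Rightarrow> complex"
  assumes "f \<in> bcontfun" "g \<in> bcontfun"
  shows "(\<lambda>t. f t * g t) \<in> bcontfun"
proof (rule bcontfun_normI)
  show "continuous_on UNIV (\<lambda>t. f t * g t)"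
    using assms by (auto simp: bcontfun_def intro!: continuous_intros)
  show "cmod (f t * g t) \<le> sup_norm f * sup_norm g" for t
    using assms by (auto simp: norm_mult sup_norm_nonneg intro!: mult_mono cmod_le_sup_norm)
qed

lemma cmult_cont:
  fixes f :: "'a::topological_space \<Rightarrow> complex"
  shows "f \<in> bcontfun \<Longrightarrow> (\<lambda>t. c * f t) \<in> bcontfun"
  by (rule mult_cont[OF const_bcontfun])

lemma cnj_cont: "f \<in> bcontfun \<Longrightarrow> (\<lambda>t. cnj (f t)) \<in> bcontfun"
  by (rule bcontfun_normI[where b = "sup_norm f"])
    (auto simp: bcontfun_def cmod_le_sup_norm intro!: continuous_intros)

lemmas bcontfun_closed = plus_cont minus_cont uminus_cont mult_cont cmult_cont cnj_cont const_bcontfun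

lemma sup_norm_triangle:
  assumes "f \<in> bcontfun" "g \<in> bcontfun"
  shows "sup_norm (\<lambda>t. f t + g t) \<le> sup_norm f + sup_norm g"
  using assms by (intro sup_norm_le plus_cont norm_triangle_le add_mono cmod_le_sup_norm)

lemma sup_norm_mult:
  assumes "f \<in> bcontfun" "g \<in> bcontfun"
  shows "sup_norm (\<lambda>t. f t * g t) \<le> sup_norm f * sup_norm g"
  using assms
  by (intro sup_norm_le mult_cont)
    (auto simp: norm_mult sup_norm_nonneg intro!: mult_mono cmod_le_sup_norm)

lemma sup_norm_cmult:
  assumes "f \<in> bcontfun"
  shows "sup_norm (\<lambda>t. c * f t) = cmod c * sup_norm f"
proof (rule antisym)
  show "sup_norm (\<lambda>t. c * f t) \<le> cmod c * sup_norm f"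
    using assms
    by (intro sup_norm_le cmult_cont) (auto simp: norm_mult intro!: mult_left_mono cmod_le_sup_norm)
  show "cmod c * sup_norm f \<le> sup_norm (\<lambda>t. c * f t)"
  proof (cases "c = 0")
    case False
    have "sup_norm f \<le> sup_norm (\<lambda>t. c * f t) / cmod c"
      using cmod_le_sup_norm[OF cmult_cont[OF assms, of c]] False assms
      by (intro sup_norm_le) (auto simp: norm_mult field_simps)
    then show ?thesis using False by (simp add: field_simps)
  qed (simp add: sup_norm_nonneg)
qed

lemma sup_norm_cnj_mult:
  assumes "f \<in> bcontfun"
  shows "sup_norm (\<lambda>t. cnj (f t) * f t) = (sup_norm f)\<^sup>2"
proof (rule antisym)
  show "sup_norm (\<lambda>t. cnj (f t) * f t) \<le> (sup_norm f)\<^sup>2"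
    using assms
    by (intro sup_norm_le bcontfun_closed)
      (auto simp: norm_mult power2_eq_square sup_norm_nonneg intro!: mult_mono cmod_le_sup_norm)
  \<comment> \<open>Upper bounds on \<open>sup_norm f\<close> come from pointwise ones, so the
    square root is taken at each t and the squaring is done after passing to the supremum.\<close>
  have "cmod (f t) \<le> sqrt (sup_norm (\<lambda>t. cnj (f t) * f t))" for t
    using cmod_le_sup_norm[OF mult_cont[OF cnj_cont[OF assms] assms], of t]
    by (intro real_le_rsqrt) (simp add: norm_mult power2_eq_square)
  then have "sup_norm f \<le> sqrt (sup_norm (\<lambda>t. cnj (f t) * f t))"
    by (intro sup_norm_le assms)
  then have "(sup_norm f)\<^sup>2 \<le> (sqrt (sup_norm (\<lambda>t. cnj (f t) * f t)))\<^sup>2"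
    by (intro power_mono sup_norm_nonneg)
  then show "(sup_norm f)\<^sup>2 \<le> sup_norm (\<lambda>t. cnj (f t) * f t)"
    by (simp add: sup_norm_nonneg)
qed

section \<open>The function algebra and its Hilbert module structure over itself\<close>

definition bcf_algebra :: "('a::metric_space \<Rightarrow> complex) cstar" where
  "bcf_algebra =
     \<lparr>carrier = bcontfun, monoid.mult = (\<lambda>f g t. f t * g t), one = (\<lambda>_. 1), zero = (\<lambda>_. 0),
      add = (\<lambda>f g t. f t + g t), smult = (\<lambda>c f t. c * f t),
      star = (\<lambda>f t. cnj (f t)), nrm = sup_norm\<rparr>"

definition bcf_module :: "('a::metric_space \<Rightarrow> complex, 'a \<Rightarrow> complex) hilbert_module" where
  "bcf_module =
     \<lparr>carrier = bcontfun, monoid.mult = (\<lambda>f g t. f t * g t), one = (\<lambda>_. 1), zero = (\<lambda>_. 0),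
      add = (\<lambda>f g t. f t + g t), smult = (\<lambda>c f t. c * f t),
      ract = (\<lambda>f g t. f t * g t), ip = (\<lambda>f g t. cnj (f t) * g t)\<rparr>"

lemma bcf_algebra_simps [simp]:
  "carrier bcf_algebra = bcontfun"
  "x \<otimes>\<^bsub>bcf_algebra\<^esub> y = (\<lambda>t. x t * y t)"
  "\<zero>\<^bsub>bcf_algebra\<^esub> = (\<lambda>_. 0)"
  "x \<oplus>\<^bsub>bcf_algebra\<^esub> y = (\<lambda>t. x t + y t)"
  "c \<odot>\<^bsub>bcf_algebra\<^esub> x = (\<lambda>t. c * x t)"
  "star bcf_algebra x = (\<lambda>t. cnj (x t))"
  "nrm bcf_algebra = sup_norm"
  by (simp_all add: bcf_algebra_def)

lemma bcf_module_simps [simp]: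
  "carrier bcf_module = bcontfun"
  "\<zero>\<^bsub>bcf_module\<^esub> = (\<lambda>_. 0)"
  "x \<oplus>\<^bsub>bcf_module\<^esub> y = (\<lambda>t. x t + y t)"
  "c \<odot>\<^bsub>bcf_module\<^esub> x = (\<lambda>t. c * x t)"
  "ract bcf_module x a = (\<lambda>t. x t * a t)"
  "ip bcf_module x y = (\<lambda>t. cnj (x t) * y t)"
  by (simp_all add: bcf_module_def)

lemma complex_ring_simps [simp]:
  "carrier complex_ring = UNIV"
  "x \<otimes>\<^bsub>complex_ring\<^esub> y = x * y"
  "\<one>\<^bsub>complex_ring\<^esub> = 1"
  "\<zero>\<^bsub>complex_ring\<^esub> = 0"
  "x \<oplus>\<^bsub>complex_ring\<^esub> y = x + y"
  by (simp_all add: complex_ring_def)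

lemma cring_complex_ring: "cring complex_ring"
proof (rule cringI)
  show "abelian_group complex_ring"
    by (rule abelian_groupI) (auto intro: exI[where x = "- _"] simp: add_eq_0_iff2)
  show "comm_monoid complex_ring"
    by (rule comm_monoidI) auto
qed (auto simp: algebra_simps)

text \<open>Stating this for any record with the pointwise operations serves both
  \<open>bcf_algebra\<close> and \<open>bcf_module\<close>, which have different record
  types.\<close>

lemma bcontfun_module:
  fixes V :: "(complex, 'a::metric_space \<Rightarrow> complex, 'm) module_scheme" (structure)
  assumes [simp]: "carrier V = bcontfun" "\<zero> = (\<lambda>_. 0)"
    "\<And>x y. x \<oplus> y = (\<lambda>t. x t + y t)" "\<And>c x. c \<odot> x = (\<lambda>t. c * x t)"
  shows "Module.module complex_ring V"
proof (rule moduleI)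
  show "abelian_group V"
  proof (rule abelian_groupI)
    show "\<exists>y\<in>carrier V. y \<oplus> x = \<zero>" if "x \<in> carrier V" for x
      using that by (intro bexI[of _ "\<lambda>t. - x t"]) (auto intro: uminus_cont)
  qed (auto intro: bcontfun_closed simp: algebra_simps)
qed (auto intro: bcontfun_closed cring_complex_ring simp: algebra_simps)

text \<open>\<open>norm_dist\<close> is built on the abstract difference of the group, which has to
  be identified with pointwise subtraction before the metric can be computed.\<close>

lemma bcontfun_minus:
  fixes V :: "(complex, 'a::metric_space \<Rightarrow> complex, 'm) module_scheme" (structure)
  assumes V: "carrier V = bcontfun" "\<zero> = (\<lambda>_. 0)"
    "\<And>x y. x \<oplus> y = (\<lambda>t. x t + y t)" "\<And>c x. c \<odot> x = (\<lambda>t. c * x t)"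
    and xy: "x \<in> bcontfun" "y \<in> bcontfun"
  shows "x \<ominus> y = (\<lambda>t. x t - y t)"
proof -
  interpret Module.module complex_ring V
    by (rule bcontfun_module) (fact V)+
  have "\<ominus> y = (\<lambda>t. - y t)"
    using xy by (intro M.minus_equality) (auto simp: V intro: uminus_cont)
  then show ?thesis by (simp add: a_minus_def V)
qed

text \<open>On the carrier, \<open>Bcontfun\<close> is an isometry onto a complete type. Agreement
  of \<nu> with \<open>sup_norm\<close> is asked only there, which is what is known about
  \<open>hnorm\<close>.\<close>

lemma bcontfun_norm_complete:
  fixes V :: "(complex, 'a::metric_space \<Rightarrow> complex, 'm) module_scheme" (structure)
  assumes V: "carrier V = bcontfun" "\<zero> = (\<lambda>_. 0)"
    "\<And>x y. x \<oplus> y = (\<lambda>t. x t + y t)" "\<And>c x. c \<odot> x = (\<lambda>t. c * x t)"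
    and \<nu>: "\<And>x. x \<in> bcontfun \<Longrightarrow> \<nu> x = sup_norm x"
  shows "norm_complete V \<nu>"
proof -
  define d where "d = norm_dist V \<nu>"
  have d: "d x y = dist (Bcontfun x) (Bcontfun y)" if "x \<in> bcontfun" "y \<in> bcontfun" for x y
  proof -
    have "Bcontfun (\<lambda>t. x t - y t) = Bcontfun x - Bcontfun y"
      using that
      by (intro bcontfun_eqI) (simp add: Bcontfun_inverse minus_cont)
    then show ?thesis
      using that bcontfun_minus[OF V that]
      by (simp add: d_def norm_dist_def V \<nu> sup_norm_def dist_norm minus_cont)
  qed
  interpret M: Metric_space bcontfun d
  proof
    fix x y :: "'a \<Rightarrow> complex"
    \<comment> \<open>Off the carrier the distance is 0 by convention, hence the case split here and
      for symmetry.\<close>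
    show "0 \<le> d x y"
      by (cases "x \<in> bcontfun \<and> y \<in> bcontfun") (auto simp: d, auto simp: d_def norm_dist_def V)
    show "d x y = d y x"
      by (cases "x \<in> bcontfun \<and> y \<in> bcontfun")
        (auto simp: d dist_commute, auto simp: d_def norm_dist_def V)
  qed (auto simp: d Bcontfun_inject dist_triangle)
  have "M.mcomplete"
    unfolding M.mcomplete_def
  proof (intro allI impI)
    fix \<sigma> :: "nat \<Rightarrow> 'a \<Rightarrow> complex"
    assume \<sigma>: "M.MCauchy \<sigma>"
    then have mem: "\<sigma> n \<in> bcontfun" for n
      by (auto simp: M.MCauchy_def)
    have "Cauchy (\<lambda>n. Bcontfun (\<sigma> n))"
      using \<sigma> by (simp add: M.MCauchy_def Cauchy_def d mem)
    then obtain l where l: "(\<lambda>n. Bcontfun (\<sigma> n)) \<longlonglongrightarrow> l"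
      using Cauchy_convergent convergent_def by blast
    have "limitin M.mtopology \<sigma> (apply_bcontfun l) sequentially"
      unfolding M.limitin_metric_dist_null
      using l mem by (auto simp: d apply_bcontfun_inverse apply_bcontfun tendsto_dist_iff[symmetric])
    then show "\<exists>x. limitin M.mtopology \<sigma> x sequentially" by blast
  qed
  then show ?thesis
    by (simp add: norm_complete_def V d_def)
qed

section \<open>Positivity of bounded continuous functions\<close>

text \<open>Every value of f lies in the spectrum, since f - f t vanishes at t. Conversely, a point
  outside the closed set of nonnegative reals keeps a positive distance from all values of f, so the
  resolvent is bounded.\<close>

lemma spectrum_bcf_algebra_subset_iff:
  fixes f :: "'a::metric_space \<Rightarrow> complex"
  assumes f: "f \<in> bcontfun"
  shows "spectrum bcf_algebra f \<subseteq> \<real>\<^sub>\<ge>\<^sub>0 \<longleftrightarrow> (\<forall>t. f t \<in> \<real>\<^sub>\<ge>\<^sub>0)"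
proof (intro iffI allI)
  fix t
  assume sp: "spectrum bcf_algebra f \<subseteq> \<real>\<^sub>\<ge>\<^sub>0"
  show "f t \<in> \<real>\<^sub>\<ge>\<^sub>0"
  proof (rule ccontr)
    assume "f t \<notin> \<real>\<^sub>\<ge>\<^sub>0"
    then have "(f, - f t) \<in> Units (unitization bcf_algebra)"
      using sp by (auto simp: spectrum_def)
    then obtain b \<beta> where
      "(\<lambda>s. f s * b s + - f t * b s + \<beta> * f s) = (\<lambda>_. 0)" and \<beta>: "- f t * \<beta> = 1"
      by (auto simp: Units_def unitization_def)
    \<comment> \<open>Evaluation at t cancels the two terms containing b.\<close>
    then have "\<beta> * f t = 0"
      by (auto dest!: fun_cong[where x = t])
    with \<beta> show False by auto
  qed
next
  assume nonneg: "\<forall>t. f t \<in> \<real>\<^sub>\<ge>\<^sub>0"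
  show "spectrum bcf_algebra f \<subseteq> \<real>\<^sub>\<ge>\<^sub>0"
  proof (rule subsetI, rule ccontr)
    fix z
    assume z: "z \<in> spectrum bcf_algebra f" "z \<notin> \<real>\<^sub>\<ge>\<^sub>0"
    \<comment> \<open>The scalar part of the inverse of \<open>(f, - z)\<close> is -1/z.\<close>
    then have z0: "z \<noteq> 0" by auto
    from z obtain e where e: "e > 0" "\<And>w. w \<in> \<real>\<^sub>\<ge>\<^sub>0 \<Longrightarrow> e \<le> dist z w"
      using separate_point_closed[OF closed_nonneg_Reals_complex] by blast
    then have e_le: "e \<le> cmod (f t - z)" for t
      using nonneg by (metis dist_commute dist_norm)
    have nz: "f t - z \<noteq> 0" for t
      using e_le[of t] e(1) by auto
    define r where "r = (\<lambda>t. inverse (f t - z))"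
    have r: "r \<in> bcontfun"
    proof (rule bcontfun_normI)
      show "continuous_on UNIV r"
        unfolding r_def using f nz by (auto simp: bcontfun_def intro!: continuous_intros)
      show "cmod (r t) \<le> inverse e" for t
        using e_le[of t] e(1) by (auto simp: r_def norm_inverse intro!: le_imp_inverse_le)
    qed
    \<comment> \<open>Subtracting the scalar part -1/z from the inverse 1/(f - z) leaves the algebra
      part 1/(f - z) + 1/z = f / (z (f - z)).\<close>
    have "(\<lambda>t. inverse z * (f t * r t)) \<in> bcontfun"
      using f r by (intro bcontfun_closed)
    moreover have "f t * (inverse z * (f t * r t)) + - z * (inverse z * (f t * r t))
        + - inverse z * f t = inverse z * f t * ((f t - z) * r t - 1)" for t
      by (simp add: algebra_simps)
    moreover have "(f t - z) * r t = 1" for t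
      using nz[of t] by (simp add: r_def)
    ultimately have "(f, - z) \<in> Units (unitization bcf_algebra)"
      using f z0
      by (auto simp: Units_def unitization_def fun_eq_iff algebra_simps
          intro!: bexI[of _ "\<lambda>t. inverse z * (f t * r t)"] exI[of _ "- inverse z"])
    with z show False by (simp add: spectrum_def)
  qed
qed

lemma cnj_nonneg_Reals: "z \<in> \<real>\<^sub>\<ge>\<^sub>0 \<Longrightarrow> cnj z = z"
  by (simp add: complex_nonneg_Reals_iff complex_eq_iff)

lemma positive_bcf_algebraI:
  assumes "f \<in> bcontfun" "\<And>t. f t \<in> \<real>\<^sub>\<ge>\<^sub>0"
  shows "f \<in> positive bcf_algebra"
  using assms by (simp add: positive_def spectrum_bcf_algebra_subset_iff cnj_nonneg_Reals)

lemma cnj_mult_nonneg: "cnj z * z \<in> \<real>\<^sub>\<ge>\<^sub>0"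
  by (simp add: complex_nonneg_Reals_iff)

text \<open>By the C*-identity the module norm is the algebra norm, so one completeness proof covers
  both.\<close>

lemma hnorm_bcf_module: "x \<in> bcontfun \<Longrightarrow> hnorm bcf_algebra bcf_module x = sup_norm x"
  by (simp add: hnorm_def sup_norm_cnj_mult sup_norm_nonneg)

lemma cstar_algebra_bcf: "cstar_algebra bcf_algebra"
proof (intro cstar_algebra.intro cstar_algebra_axioms.intro)
  show "Module.module complex_ring bcf_algebra"
    by (rule bcontfun_module) simp_all
  show "norm_complete bcf_algebra (nrm bcf_algebra)"
    by (rule bcontfun_norm_complete) simp_all
qed (simp_all add: bcontfun_closed sup_norm_nonneg sup_norm_eq_0_iff sup_norm_cmult
    sup_norm_cnj_mult sup_norm_triangle sup_norm_mult, simp_all add: algebra_simps)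

lemma hilbert_cstar_module_bcf: "hilbert_cstar_module bcf_algebra bcf_module"
proof (intro hilbert_cstar_module.intro hilbert_cstar_module_axioms.intro cstar_algebra_bcf)
  show "Module.module complex_ring bcf_module"
    by (rule bcontfun_module) simp_all
  show "norm_complete bcf_module (hnorm bcf_algebra bcf_module)"
    by (rule bcontfun_norm_complete) (simp_all add: hnorm_bcf_module)
  show "ip bcf_module x x \<in> positive bcf_algebra" if "x \<in> carrier bcf_module"
    for x :: "'a \<Rightarrow> complex"
    using that cnj_mult_nonneg by (auto intro!: positive_bcf_algebraI bcontfun_closed)
qed (auto simp: algebra_simps fun_eq_iff intro: bcontfun_closed)

section \<open>Multiplication operators\<close>

text \<open>The restriction to \<open>bcontfun\<close> follows the convention that operators are
  \<open>undefined\<close> off the carrier.\<close>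

definition mult_op :: "('a::metric_space \<Rightarrow> complex) \<Rightarrow> ('a \<Rightarrow> complex) \<Rightarrow> 'a \<Rightarrow> complex" where
  "mult_op h = (\<lambda>x \<in> bcontfun. \<lambda>t. h t * x t)"

lemma mult_op_apply: "x \<in> bcontfun \<Longrightarrow> mult_op h x = (\<lambda>t. h t * x t)"
  by (simp add: mult_op_def)

lemma mult_op_inject: "mult_op f = mult_op g \<longleftrightarrow> f = g"
proof
  assume "mult_op f = mult_op g"
  then have "mult_op f (\<lambda>_. 1) = mult_op g (\<lambda>_. 1)" by simp
  then show "f = g" by (simp add: mult_op_apply const_bcontfun)
qed simp

abbreviation bcf_operators where
  "bcf_operators \<equiv> adjointable bcf_algebra bcf_module"

lemma is_adjoint_mult_op:
  assumes "h \<in> bcontfun"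
  shows "is_adjoint bcf_module (mult_op h) (mult_op (\<lambda>t. cnj (h t)))"
  using assms by (auto simp: is_adjoint_def mult_op_def fun_eq_iff intro: bcontfun_closed)

text \<open>The adjoint relation holds at each point t. Putting x = 1 makes S multiplication by the
  conjugate of T 1; then y = 1 makes T multiplication by T 1. Describing S along with T also yields
  uniqueness of adjoints.\<close>

lemma is_adjoint_bcf_moduleD:
  fixes T S :: "('a::metric_space \<Rightarrow> complex) \<Rightarrow> 'a \<Rightarrow> complex"
  assumes "is_adjoint bcf_module T S"
  shows "\<exists>h\<in>bcontfun. T = mult_op h \<and> S = mult_op (\<lambda>t. cnj (h t))"
proof -
  let ?u = "\<lambda>_::'a. 1::complex"
  have T: "T \<in> bcontfun \<rightarrow>\<^sub>E bcontfun" and S: "S \<in> bcontfun \<rightarrow>\<^sub>E bcontfun"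
    using assms by (auto simp: is_adjoint_def)
  have adj: "cnj (T x t) * y t = cnj (x t) * S y t"
    if "x \<in> bcontfun" "y \<in> bcontfun" for x y t
    using assms that by (auto simp: is_adjoint_def fun_eq_iff)
  have Sy: "S y t = cnj (T ?u t) * y t" if "y \<in> bcontfun" for y t
    using adj[OF const_bcontfun that, of 1 t] by simp
  have Tx: "T x t = T ?u t * x t" if "x \<in> bcontfun" for x t
    using adj[OF that const_bcontfun, of t 1] Sy[OF const_bcontfun, of 1 t]
    by (metis complex_cnj_cnj complex_cnj_mult mult.commute mult.right_neutral)
  have "T ?u \<in> bcontfun"
    using T const_bcontfun by blast
  moreover have "T = mult_op (T ?u)"
    using T Tx by (intro extensionalityI[of _ bcontfun]) (auto simp: mult_op_def PiE_def)
  moreover have "S = mult_op (\<lambda>t. cnj (T ?u t))"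
    using S Sy by (intro extensionalityI[of _ bcontfun]) (auto simp: mult_op_def PiE_def)
  ultimately show ?thesis by blast
qed

section \<open>Multiplication operators as a *-isomorphic copy of the function algebra\<close>

lemma carrier_bcf_operators: "carrier bcf_operators = mult_op ` bcontfun"
  using is_adjoint_mult_op by (fastforce simp: adjointable_def dest: is_adjoint_bcf_moduleD)

lemma mult_op_mult:
  assumes "f \<in> bcontfun" "g \<in> bcontfun"
  shows "mult_op f \<otimes>\<^bsub>bcf_operators\<^esub> mult_op g = mult_op (\<lambda>t. f t * g t)"
  using assms
  by (auto simp: adjointable_def compose_def mult_op_def fun_eq_iff mult.assoc intro: bcontfun_closed)

lemma mult_op_add:
  "mult_op f \<oplus>\<^bsub>bcf_operators\<^esub> mult_op g = mult_op (\<lambda>t. f t + g t)"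
  by (auto simp: adjointable_def mult_op_def fun_eq_iff distrib_right)

lemma mult_op_smult:
  "c \<odot>\<^bsub>bcf_operators\<^esub> mult_op g = mult_op (\<lambda>t. c * g t)"
  by (auto simp: adjointable_def mult_op_def fun_eq_iff)

lemma zero_bcf_operators: "\<zero>\<^bsub>bcf_operators\<^esub> = mult_op (\<lambda>_. 0)"
  by (auto simp: adjointable_def mult_op_def fun_eq_iff)

lemma star_mult_op:
  assumes "h \<in> bcontfun"
  shows "star bcf_operators (mult_op h) = mult_op (\<lambda>t. cnj (h t))"
proof -
  have "(THE S. is_adjoint bcf_module (mult_op h) S) = mult_op (\<lambda>t. cnj (h t))"
    by (rule the_equality)
      (auto intro: is_adjoint_mult_op[OF assms] dest!: is_adjoint_bcf_moduleD simp: mult_op_inject)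
  then show ?thesis by (simp add: adjointable_def)
qed

section \<open>Spectrum, positivity and square roots of multiplication operators\<close>

lemma Units_unitization_iff:
  "(a, \<alpha>) \<in> Units (unitization \<AA>) \<longleftrightarrow> a \<in> carrier \<AA> \<and>
     (\<exists>b\<in>carrier \<AA>. \<exists>\<beta>.
        (b \<otimes>\<^bsub>\<AA>\<^esub> a) \<oplus>\<^bsub>\<AA>\<^esub> (\<beta> \<odot>\<^bsub>\<AA>\<^esub> a) \<oplus>\<^bsub>\<AA>\<^esub> (\<alpha> \<odot>\<^bsub>\<AA>\<^esub> b) = \<zero>\<^bsub>\<AA>\<^esub> \<and> \<beta> * \<alpha> = 1 \<and>
        (a \<otimes>\<^bsub>\<AA>\<^esub> b) \<oplus>\<^bsub>\<AA>\<^esub> (\<alpha> \<odot>\<^bsub>\<AA>\<^esub> b) \<oplus>\<^bsub>\<AA>\<^esub> (\<beta> \<odot>\<^bsub>\<AA>\<^esub> a) = \<zero>\<^bsub>\<AA>\<^esub> \<and> \<alpha> * \<beta> = 1)"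
  by (auto simp: Units_def unitization_def)

text \<open>Invertibility in the unitization amounts to equations in the algebra operations, and
  \<open>mult_op\<close> carries these over bijectively.\<close>

lemma spectrum_mult_op:
  assumes "f \<in> bcontfun"
  shows "spectrum bcf_operators (mult_op f) = spectrum bcf_algebra f"
proof -
  have "(mult_op f, - z) \<in> Units (unitization bcf_operators) \<longleftrightarrow>
      (f, - z) \<in> Units (unitization bcf_algebra)" for z
    using assms
    by (simp add: Units_unitization_iff carrier_bcf_operators mult_op_mult mult_op_smult
        mult_op_add zero_bcf_operators mult_op_inject cong: bex_cong)
  then show ?thesis by (simp add: spectrum_def)
qed

lemma mult_op_positive_iff:
  assumes "f \<in> bcontfun"
  shows "mult_op f \<in> positive bcf_operators \<longleftrightarrow> (\<forall>t. f t \<in> \<real>\<^sub>\<ge>\<^sub>0)"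
  using assms
  by (auto simp: positive_def spectrum_mult_op spectrum_bcf_algebra_subset_iff
      carrier_bcf_operators star_mult_op cnj_nonneg_Reals)

lemma nonneg_Reals_square_inject:
  fixes z w :: complex
  assumes "z \<in> \<real>\<^sub>\<ge>\<^sub>0" "w \<in> \<real>\<^sub>\<ge>\<^sub>0" "z * z = w * w"
  shows "z = w"
  using assms by (auto simp: square_eq_iff complex_nonneg_Reals_iff complex_eq_iff)

text \<open>For uniqueness, any positive root is again some \<open>mult_op g\<close> with g
  nonnegative, and a nonnegative number is determined by its square, so g = f pointwise.\<close>

lemma positive_sqrt_mult_op:
  assumes f: "f \<in> bcontfun" "\<And>t. f t \<in> \<real>\<^sub>\<ge>\<^sub>0"
  shows "positive_sqrt bcf_operators (mult_op (\<lambda>t. f t * f t)) = mult_op f"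
  unfolding positive_sqrt_def
proof (rule the_equality)
  fix s
  assume s: "s \<in> positive bcf_operators \<and> s \<otimes>\<^bsub>bcf_operators\<^esub> s = mult_op (\<lambda>t. f t * f t)"
  then obtain g where g: "g \<in> bcontfun" "s = mult_op g"
    by (auto simp: positive_def carrier_bcf_operators)
  with s have "(\<lambda>t. g t * g t) = (\<lambda>t. f t * f t)" "\<forall>t. g t \<in> \<real>\<^sub>\<ge>\<^sub>0"
    by (auto simp: mult_op_mult mult_op_inject mult_op_positive_iff)
  then have "g t = f t" for t
    using f nonneg_Reals_square_inject[of "g t" "f t"] by (simp add: fun_eq_iff)
  then have "g = f" by (rule ext)
  with g show "s = mult_op f" by simp
qed (use f in \<open>simp add: mult_op_mult mult_op_positive_iff\<close>)

section \<open>The counterexample\<close>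

definition ramp :: "real \<Rightarrow> complex" where
  "ramp t = complex_of_real (max 0 (min 1 t))"

text \<open>The factor c covers \<open>ramp\<close> and its reflection at once, through c = 1 and c
  = -1.\<close>

lemma continuous_on_ramp: "continuous_on S (\<lambda>t. ramp (c * t))"
  unfolding ramp_def by (intro continuous_intros)

lemma ramp_scaled_bcontfun: "(\<lambda>t. ramp (c * t)) \<in> bcontfun"
  by (rule bcontfun_normI[where b = 1]) (rule continuous_on_ramp, simp add: ramp_def)

lemma ramp_nonneg: "ramp t \<in> \<real>\<^sub>\<ge>\<^sub>0"
  by (simp add: ramp_def)

lemma no_continuous_quotient:
  assumes "continuous_on UNIV h"
  shows "\<not> (\<forall>t. ramp t = (ramp t + ramp (- t)) * h t)"
proof
  assume *: "\<forall>t. ramp t = (ramp t + ramp (- t)) * h t"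
  \<comment> \<open>Away from 0 exactly one of the two ramps is nonzero and can be cancelled. At 0
    the equation reads 0 = 0, so \<open>h 0\<close> is reached only through one-sided
    limits.\<close>
  have pos: "h t = 1" if "t > 0" for t
    using *[rule_format, of t] that by (auto simp: ramp_def)
  have neg: "h t = 0" if "t < 0" for t
    using *[rule_format, of t] that by (auto simp: ramp_def max_def min_def split: if_splits)
  have lim: "(h \<longlongrightarrow> h 0) (at 0)"
    using assms by (simp add: continuous_on_def)
  have "(h \<longlongrightarrow> 1) (at_right 0)"
    by (rule tendsto_eventually) (auto simp: eventually_at_filter pos)
  moreover have "(h \<longlongrightarrow> 0) (at_left 0)"
    by (rule tendsto_eventually) (auto simp: eventually_at_filter neg)
  ultimately have "h 0 = 1" "h 0 = 0"
    using lim unfolding filterlim_at_split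
    by (metis tendsto_unique trivial_limit_at_right_real trivial_limit_at_left_real)+
  then show False by simp
qed

theorem proposition6p2:
  shows "\<exists>(\<AA> :: (real \<Rightarrow> complex) cstar)
          (H :: (real \<Rightarrow> complex, real \<Rightarrow> complex) hilbert_module) A B.
    hilbert_cstar_module \<AA> H \<and>
    A \<in> positive (adjointable \<AA> H) \<and>
    B \<in> positive (adjointable \<AA> H) \<and>
    \<not> (\<exists>X \<in> carrier (adjointable \<AA> H).
        positive_sqrt (adjointable \<AA> H) A =
        positive_sqrt (adjointable \<AA> H) (A \<oplus>\<^bsub>adjointable \<AA> H\<^esub> B)
          \<otimes>\<^bsub>adjointable \<AA> H\<^esub> X)"
proof -
  define u v w where "u = ramp" and "v = (\<lambda>t. ramp (- t))" and "w = (\<lambda>t. u t + v t)"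
  have mem: "u \<in> bcontfun" "v \<in> bcontfun" "w \<in> bcontfun"
    using ramp_scaled_bcontfun[of 1] ramp_scaled_bcontfun[of "-1"]
    by (auto simp: u_def v_def w_def intro: plus_cont)
  have nonneg: "u t \<in> \<real>\<^sub>\<ge>\<^sub>0" "v t \<in> \<real>\<^sub>\<ge>\<^sub>0" "w t \<in> \<real>\<^sub>\<ge>\<^sub>0" for t
    by (auto simp: u_def v_def w_def ramp_nonneg)
  let ?A = "mult_op (\<lambda>t. u t * u t)" and ?B = "mult_op (\<lambda>t. v t * v t)"
  have pos: "?A \<in> positive bcf_operators" "?B \<in> positive bcf_operators"
    using mem nonneg by (auto simp: mult_op_positive_iff mult_cont)
  \<comment> \<open>The cross terms 2 u v of the square vanish, as u and v are never both
    nonzero.\<close>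
  have "u t * u t + v t * v t = w t * w t" for t
    by (simp add: u_def v_def w_def ramp_def max_def min_def)
  then have AB: "?A \<oplus>\<^bsub>bcf_operators\<^esub> ?B = mult_op (\<lambda>t. w t * w t)"
    by (simp add: mult_op_add)
  have "\<not> (\<exists>X \<in> carrier bcf_operators. positive_sqrt bcf_operators ?A =
      positive_sqrt bcf_operators (?A \<oplus>\<^bsub>bcf_operators\<^esub> ?B) \<otimes>\<^bsub>bcf_operators\<^esub> X)"
  proof
    assume "\<exists>X \<in> carrier bcf_operators. positive_sqrt bcf_operators ?A =
      positive_sqrt bcf_operators (?A \<oplus>\<^bsub>bcf_operators\<^esub> ?B) \<otimes>\<^bsub>bcf_operators\<^esub> X"
    \<comment> \<open>X is itself a multiplication operator, so injectivity of
      \<open>mult_op\<close> will reduce the operator equation to one between functions.\<close>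
    then obtain h where h: "h \<in> bcontfun"
      and "mult_op u = mult_op w \<otimes>\<^bsub>bcf_operators\<^esub> mult_op h"
      using mem nonneg by (auto simp: AB positive_sqrt_mult_op carrier_bcf_operators)
    then have "u = (\<lambda>t. w t * h t)"
      using mem by (simp add: mult_op_mult mult_op_inject)
    then have "\<forall>t. ramp t = (ramp t + ramp (- t)) * h t"
      by (auto simp: u_def v_def w_def fun_eq_iff)
    with no_continuous_quotient h show False
      by (auto simp: bcontfun_def)
  qed
  with pos hilbert_cstar_module_bcf show ?thesis by blast
qed

end
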